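(* For every integer $k\ge 1$ and all positive integers $e,n$ with $e\le \frac{n^2}{4}$ we have $$ex_{bip}(n,e,S_k)=N(S_k,B^e_n).$$
   Context: $S_k$ denotes the star with $k$ leaves. For graphs $H,G$, $N(H,G)$ is the number of subgraphs of $G$ isomorphic to $H$. $ex_{bip}(n,e,H)=\max\{N(H,B): B \text{ bipartite}, |V(B)|=n, |E(B)|=e\}$. For positive integers $n,e$ with $e\le n^2/4$, let $t$ be the smallest positive integer $i$ with $i(n-i)\ge e$ (so $1\le t\le n/2$); the quasi-complete bipartite graph $B^e_n$ is obtained from the complete bipartite graph $K_{t,n-t}$ by picking a vertex of degree $n-t$ and deleting $t(n-t)-e$ of its edges. *)

theory Defs
  imports Complex_Main
begin

(* A graph is a pair of a vertex set and a set of edges, an edge being a two-element set. *)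
type_synonym 'a ugraph = "'a set \<times> 'a set set"

abbreviation verts :: "'a ugraph \<Rightarrow> 'a set" where
  "verts G \<equiv> fst G"

abbreviation edges :: "'a ugraph \<Rightarrow> 'a set set" where
  "edges G \<equiv> snd G"

definition finite_simple_graph :: "'a ugraph \<Rightarrow> bool" where
  "finite_simple_graph G \<longleftrightarrow>
     finite (verts G) \<and> (\<forall>d\<in>edges G. d \<subseteq> verts G \<and> card d = 2)"

definition subgraph_of :: "'a ugraph \<Rightarrow> 'a ugraph \<Rightarrow> bool" where
  "subgraph_of H G \<longleftrightarrow>
     finite_simple_graph H \<and> verts H \<subseteq> verts G \<and> edges H \<subseteq> edges G"

definition isomorphic_graphs :: "'a ugraph \<Rightarrow> 'b ugraph \<Rightarrow> bool" where
  "isomorphic_graphs G H \<longleftrightarrow>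
     (\<exists>f. bij_betw f (verts G) (verts H) \<and> edges H = (\<lambda>d. f ` d) ` edges G)"

(* N(H, G): unlabelled copies, so each subgraph counts once, whatever its automorphisms.
   In particular N(S_1, G) is the number of edges of G. *)
definition num_copies :: "'b ugraph \<Rightarrow> 'a ugraph \<Rightarrow> nat" where
  "num_copies H G = card {H'. subgraph_of H' G \<and> isomorphic_graphs H' H}"

definition bipartite_graph :: "'a ugraph \<Rightarrow> bool" where
  "bipartite_graph G \<longleftrightarrow> finite_simple_graph G \<and>
     (\<exists>X Y. X \<union> Y = verts G \<and> X \<inter> Y = {} \<and>
        (\<forall>d\<in>edges G. \<exists>x\<in>X. \<exists>y\<in>Y. d = {x, y}))"

definition star :: "nat \<Rightarrow> nat ugraph" where
  "star k = ({0..k}, {{0, i} | i. i \<in> {1..k}})"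

(* Every finite graph is isomorphic to one with vertices in nat, so ranging over
   nat graphs is no restriction.  The set of values is finite, because a graph with n
   vertices and e edges has at most 2 ^ (n + e) subgraphs. *)
definition ex_bip :: "nat \<Rightarrow> nat \<Rightarrow> 'b ugraph \<Rightarrow> nat" where
  "ex_bip n e H = Max {num_copies H B | B :: nat ugraph.
     bipartite_graph B \<and> card (verts B) = n \<and> card (edges B) = e}"

definition complete_bipartite :: "nat \<Rightarrow> nat \<Rightarrow> nat ugraph" where
  "complete_bipartite a b = ({..<a + b}, {{x, y} | x y. x \<in> {..<a} \<and> y \<in> {a..<a + b}})"

(* For 0 < e the truncated subtraction is harmless: for i > n the product is 0 < e. *)
definition qcb_size :: "nat \<Rightarrow> nat \<Rightarrow> nat" where
  "qcb_size n e = (LEAST i. 0 < i \<and> e \<le> i * (n - i))"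

(* The quasi-complete bipartite graph is determined only up to isomorphism; here the
   picked vertex, of degree n - t in K_{t, n-t}, is 0, and the deleted edges are those to
   the first t(n - t) - e of its n - t neighbours t, ..., n - 1.  There are enough of
   them, since (t - 1)(n - t + 1) < e by minimality of t. *)
definition quasi_complete_bipartite :: "nat \<Rightarrow> nat \<Rightarrow> nat ugraph" where
  "quasi_complete_bipartite n e =
     (let t = qcb_size n e; K = complete_bipartite t (n - t)
      in (verts K, edges K - {{0, y} | y. y \<in> {t..<t + (t * (n - t) - e)}}))"

end

theory Submission
  imports Defs
begin

text \<open>For \<open>k \<ge> 2\<close> the number of copies of \<open>S\<^sub>k\<close> is the sum of \<open>d(v) choose k\<close> over the vertices.
  Let \<open>T\<^sub>c\<close> be the sum of the truncated differences \<open>d(v) - c\<close>.  As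
  \<open>d choose k = (\<Sum>c\<ge>1. ((c - 1) choose (k - 2)) * (d - c))\<close>, with weights nondecreasing in \<open>c\<close>,
  the theorem follows from the case \<open>k = 2\<close> once the difference \<open>D\<^sub>c\<close> between \<open>T\<^sub>c\<close> of the
  quasi-complete graph and \<open>T\<^sub>c\<close> of another bipartite graph changes sign at most once, from
  negative to positive.  Indeed \<open>D\<^sub>c \<le> 0\<close> for \<open>c < t\<close>, where the quasi-complete graph attains the
  trivial lower bound \<open>2 e - n c\<close>.  For \<open>c \<ge> t\<close>, either one side has at most \<open>c\<close> vertices of degree
  above \<open>c\<close>, and then \<open>D\<^sub>c \<ge> 0\<close>, or both have more, and then \<open>D\<^sub>c \<le> D\<^sub>c\<^sub>+\<^sub>1\<close>, because the
  quasi-complete graph has at most \<open>t\<close> vertices of degree above \<open>c\<close>.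

  For \<open>k = 2\<close> the only constraint needed is that all degrees are at most \<open>w = n - t\<close>, which holds
  since both sides have at least \<open>t\<close> vertices.  Removing a vertex of degree \<open>w\<close> changes the sum of
  squares of the degrees exactly as in the extremal graph; if there is none, \<open>w\<close> can be decreased.\<close>

section \<open>Degree sums over the sides of a bipartite edge set\<close>

definition deg :: "'a set set \<Rightarrow> 'a \<Rightarrow> nat" where
  "deg E v = card {d \<in> E. v \<in> d}"

text \<open>The sides are fixed independently of \<open>E\<close>, so deleting edges stays within
  the locale with the same \<open>X\<close> and \<open>Y\<close>. The sides enter symmetrically, and
  \<open>swap\<close> transfers every one-sided fact to \<open>Y\<close>.\<close>

locale bipartite_edges =
  fixes X Y :: "'a set" and E :: "'a set set"
  assumes finite_X: "finite X" and finite_Y: "finite Y" and disjoint: "X \<inter> Y = {}"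
    and edge: "d \<in> E \<Longrightarrow> \<exists>x\<in>X. \<exists>y\<in>Y. d = {x, y}"
begin

lemma swap: "bipartite_edges Y X E"
  using finite_X finite_Y disjoint edge by unfold_locales (auto, metis insert_commute)

lemma subset: "E' \<subseteq> E \<Longrightarrow> bipartite_edges X Y E'"
  using finite_X finite_Y disjoint edge by unfold_locales auto

lemma finite_E: "finite E"
proof (rule finite_subset)
  show "E \<subseteq> Pow (X \<union> Y)" using edge by blast
qed (simp add: finite_X finite_Y)

text \<open>Every edge has exactly one end in \<open>X\<close>, so different vertices of
  \<open>P\<close> have disjoint sets of incident edges.\<close>

lemma sum_deg_subset:
  assumes "P \<subseteq> X"
  shows "(\<Sum>v\<in>P. deg E v) = card {d \<in> E. d \<inter> P \<noteq> {}}"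
proof -
  have "card (\<Union>v\<in>P. {d \<in> E. v \<in> d}) = (\<Sum>v\<in>P. card {d \<in> E. v \<in> d})"
  proof (rule card_UN_disjoint)
    show "finite P" using assms finite_X finite_subset by blast
    show "\<forall>v\<in>P. finite {d \<in> E. v \<in> d}" using finite_E by simp
    show "\<forall>v\<in>P. \<forall>u\<in>P. v \<noteq> u \<longrightarrow> {d \<in> E. v \<in> d} \<inter> {d \<in> E. u \<in> d} = {}"
      using edge disjoint assms by fastforce
  qed
  moreover have "(\<Union>v\<in>P. {d \<in> E. v \<in> d}) = {d \<in> E. d \<inter> P \<noteq> {}}" by blast
  ultimately show ?thesis by (simp add: deg_def)
qed

lemma sum_deg_le: "P \<subseteq> X \<Longrightarrow> (\<Sum>v\<in>P. deg E v) \<le> card E"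
  by (simp add: sum_deg_subset card_mono finite_E)

lemma sum_deg_X: "(\<Sum>v\<in>X. deg E v) = card E"
proof -
  have "{d \<in> E. d \<inter> X \<noteq> {}} = E" using edge by blast
  then show ?thesis by (simp add: sum_deg_subset)
qed

lemma sum_union: "(\<Sum>v\<in>X \<union> Y. f v) = (\<Sum>v\<in>X. f v) + (\<Sum>v\<in>Y. (f v :: nat))"
  by (simp add: sum.union_disjoint finite_X finite_Y disjoint)

lemma sum_deg: "(\<Sum>v\<in>X \<union> Y. deg E v) = 2 * card E"
  using sum_deg_X bipartite_edges.sum_deg_X[OF swap] by (simp add: sum_union)

lemma deg_le:
  assumes "x \<in> X"
  shows "deg E x \<le> card Y"
proof -
  have "{d \<in> E. x \<in> d} \<subseteq> (\<lambda>y. {x, y}) ` Y"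
    using edge disjoint assms by fastforce
  then show ?thesis
    unfolding deg_def using finite_Y surj_card_le by blast
qed

lemma card_E_le: "card E \<le> card X * card Y"
proof -
  have "(\<Sum>v\<in>X. deg E v) \<le> (\<Sum>v\<in>X. card Y)" by (rule sum_mono) (rule deg_le)
  then show ?thesis by (simp add: sum_deg_X)
qed

text \<open>Inclusion-exclusion: the edges counted from both sides join \<open>P\<close> to
  \<open>Q\<close>, and there are at most \<open>card P * card Q\<close> such pairs.\<close>

lemma sum_deg_two_sides:
  assumes P: "P \<subseteq> X" and Q: "Q \<subseteq> Y"
  shows "(\<Sum>v\<in>P. deg E v) + (\<Sum>v\<in>Q. deg E v) \<le> card E + card P * card Q"
proof -
  let ?A = "{d \<in> E. d \<inter> P \<noteq> {}}" and ?B = "{d \<in> E. d \<inter> Q \<noteq> {}}"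
  have "?A \<inter> ?B \<subseteq> (\<lambda>(x, y). {x, y}) ` (P \<times> Q)"
  proof
    fix d assume d: "d \<in> ?A \<inter> ?B"
    then obtain x y where "x \<in> X" "y \<in> Y" "d = {x, y}" using edge by blast
    moreover from this d have "x \<in> P" "y \<in> Q" using P Q disjoint by auto
    ultimately show "d \<in> (\<lambda>(x, y). {x, y}) ` (P \<times> Q)" by force
  qed
  moreover have "finite (P \<times> Q)"
    using P Q finite_X finite_Y finite_subset by blast
  ultimately have "card (?A \<inter> ?B) \<le> card (P \<times> Q)" by (meson surj_card_le)
  moreover have "card (?A \<union> ?B) \<le> card E"
    by (rule card_mono) (auto simp: finite_E)
  moreover have "card ?A + card ?B = card (?A \<union> ?B) + card (?A \<inter> ?B)"
    by (rule card_Un_Int) (simp_all add: finite_E)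
  ultimately show ?thesis
    using sum_deg_subset[OF P] bipartite_edges.sum_deg_subset[OF swap Q]
    by (simp add: card_cartesian_product)
qed

text \<open>The degrees of the neighbours of \<open>x\<close> add up to at most \<open>card E\<close>, because no edge
  joins two of them.\<close>

lemma sum_deg_squares_remove:
  assumes x: "x \<in> X"
  shows "(\<Sum>v\<in>X \<union> Y. (deg E v)\<^sup>2) + deg E x \<le>
    (\<Sum>v\<in>X \<union> Y. (deg {d \<in> E. x \<notin> d} v)\<^sup>2) + (deg E x)\<^sup>2 + 2 * card E"
proof -
  define E' where "E' = {d \<in> E. x \<notin> d}"
  define N where "N = {y \<in> Y. {x, y} \<in> E}"
  interpret E': bipartite_edges X Y E' by (rule subset) (simp add: E'_def)
  have incident: "{d \<in> E. x \<in> d} = (\<lambda>y. {x, y}) ` N"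
    using edge disjoint x by (fastforce simp: N_def)
  have "inj_on (\<lambda>y. {x, y}) N" by (auto simp: inj_on_def doubleton_eq_iff)
  then have card_N: "card N = deg E x"
    by (simp add: deg_def incident card_image)
  have card_E: "card E = card E' + deg E x"
  proof -
    have "E = E' \<union> {d \<in> E. x \<in> d}" by (auto simp: E'_def)
    moreover have "card (E' \<union> {d \<in> E. x \<in> d}) = card E' + card {d \<in> E. x \<in> d}"
      by (rule card_Un_disjoint) (auto simp: E'_def finite_E)
    ultimately show ?thesis by (simp add: deg_def)
  qed
  have deg_X: "deg E v = deg E' v" if "v \<in> X - {x}" for v
  proof -
    have "{d \<in> E. v \<in> d} = {d \<in> E'. v \<in> d}"
      using that edge disjoint x by (fastforce simp: E'_def)
    then show ?thesis by (simp add: deg_def)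
  qed
  have deg_Y: "deg E v = deg E' v + (if v \<in> N then 1 else 0)" if "v \<in> Y" for v
  proof -
    have pair: "d = {x, v}" if "d \<in> E" "x \<in> d" "v \<in> d" for d
      using edge[OF that(1)] that x \<open>v \<in> Y\<close> disjoint by auto
    have both: "{d \<in> E. x \<in> d \<and> v \<in> d} = (if v \<in> N then {{x, v}} else {})"
    proof (cases "{x, v} \<in> E")
      case True
      then have "{d \<in> E. x \<in> d \<and> v \<in> d} = {{x, v}}" using pair by blast
      then show ?thesis using True \<open>v \<in> Y\<close> by (simp add: N_def)
    next
      case False
      then have "{d \<in> E. x \<in> d \<and> v \<in> d} = {}" using pair by blast
      then show ?thesis using False by (simp add: N_def)
    qed
    have *: "{d \<in> E. v \<in> d} = {d \<in> E'. v \<in> d} \<union> {d \<in> E. x \<in> d \<and> v \<in> d}"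
      by (auto simp: E'_def)
    have "card ({d \<in> E'. v \<in> d} \<union> {d \<in> E. x \<in> d \<and> v \<in> d})
        = card {d \<in> E'. v \<in> d} + card {d \<in> E. x \<in> d \<and> v \<in> d}"
      by (rule card_Un_disjoint) (auto simp: finite_E E'_def)
    then show ?thesis by (simp add: deg_def * both)
  qed
  have deg_x: "deg E' x = 0" by (auto simp: deg_def E'_def)
  have "(\<Sum>v\<in>X. (deg E v)\<^sup>2) = (deg E x)\<^sup>2 + (\<Sum>v\<in>X - {x}. (deg E' v)\<^sup>2)"
    using x finite_X deg_X by (simp add: sum.remove)
  also have "\<dots> = (deg E x)\<^sup>2 + (\<Sum>v\<in>X. (deg E' v)\<^sup>2)"
    using x finite_X deg_x by (simp add: sum.remove[of X x])
  finally have sX: "(\<Sum>v\<in>X. (deg E v)\<^sup>2) = (deg E x)\<^sup>2 + (\<Sum>v\<in>X. (deg E' v)\<^sup>2)" .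
  have "(\<Sum>v\<in>Y. (deg E v)\<^sup>2)
      = (\<Sum>v\<in>Y. (deg E' v)\<^sup>2 + (if v \<in> N then 2 * deg E' v + 1 else 0))"
    by (rule sum.cong) (auto simp: deg_Y power2_eq_square)
  also have "\<dots> = (\<Sum>v\<in>Y. (deg E' v)\<^sup>2) + (\<Sum>v\<in>N. 2 * deg E' v + 1)"
    using finite_Y by (simp add: sum.distrib sum.If_cases N_def Int_def conj_commute)
  also have "(\<Sum>v\<in>N. 2 * deg E' v + 1) = 2 * (\<Sum>v\<in>N. deg E' v) + card N"
    by (simp only: sum.distrib sum_distrib_left) simp
  finally have sY: "(\<Sum>v\<in>Y. (deg E v)\<^sup>2)
      = (\<Sum>v\<in>Y. (deg E' v)\<^sup>2) + (2 * (\<Sum>v\<in>N. deg E' v) + card N)" .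
  \<comment> \<open>With \<open>card N = deg E x\<close> and
    \<open>card E' = card E - deg E x\<close>, the sum over \<open>Y\<close> grows by at most
    \<open>2 * card E' + card N = 2 * card E - deg E x\<close>.\<close>
  have "(\<Sum>v\<in>N. deg E' v) \<le> card E'"
    by (rule bipartite_edges.sum_deg_le[OF E'.swap]) (auto simp: N_def)
  then show ?thesis
    unfolding E'_def[symmetric] using sX sY card_E card_N by (simp add: sum_union)
qed

end

section \<open>Extremal sum of squared degrees under a degree bound\<close>

text \<open>The sum of the squared degrees over both sides when one side consists of \<open>q\<close> vertices
  of degree \<open>w\<close> and one of degree \<open>r\<close>, with nested neighbourhoods.\<close>

definition nested_squares :: "nat \<Rightarrow> nat \<Rightarrow> nat" where
  "nested_squares w m =
     (let q = m div w; r = m mod w in q * w * (w + q) + 2 * r * q + r * r + r)"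

lemma nested_squares_eq:
  assumes "r \<le> w"
  shows "nested_squares w (q * w + r) = q * w * (w + q) + 2 * r * q + r * r + r"
proof (cases "r = w")
  case True
  have "q * w + w = Suc q * w" by simp
  then show ?thesis
    using True by (cases "w = 0") (simp_all add: nested_squares_def algebra_simps)
next
  case False
  then show ?thesis using assms by (simp add: nested_squares_def)
qed

text \<open>This is the bound of \<open>sum_deg_squares_remove\<close> for a vertex of degree
  \<open>w\<close>, with equality; it drives the induction in
  \<open>sum_deg_squares_le\<close>.\<close>

lemma nested_squares_add:
  assumes "0 < w" and "w \<le> m"
  shows "nested_squares w m + w = nested_squares w (m - w) + w\<^sup>2 + 2 * m"
proof -
  define q r where "q = (m - w) div w" and "r = (m - w) mod w"
  have r: "r \<le> w" using assms(1) by (simp add: r_def less_imp_le)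
  have m': "m - w = q * w + r" by (simp add: q_def r_def)
  then have m: "m = Suc q * w + r" using assms by simp
  show ?thesis
    unfolding m' nested_squares_eq[OF r]
    unfolding m nested_squares_eq[OF r]
    by (simp add: algebra_simps power2_eq_square)
qed

text \<open>Divide \<open>m\<close> by \<open>Suc w\<close> with quotient \<open>q\<close> and
  remainder \<open>r\<close>. Passing to \<open>w\<close> takes one edge from each of the
  \<open>q\<close> full vertices, so the remainder becomes \<open>q + r\<close>, possibly with a
  carry.\<close>

lemma nested_squares_mono:
  assumes "m < Suc w * w"
  shows "nested_squares w m \<le> nested_squares (Suc w) m"
proof -
  define q r where "q = m div Suc w" and "r = m mod Suc w"
  have m: "m = q * Suc w + r" unfolding q_def r_def by (rule div_mult_mod_eq[symmetric])
  have r: "r \<le> w" using mod_less_divisor[of "Suc w" m] unfolding r_def by linarith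
  have q: "q < w" using assms unfolding q_def by (simp add: less_mult_imp_div_less mult.commute)
  have B: "nested_squares (Suc w) m = q * Suc w * (Suc w + q) + 2 * r * q + r * r + r"
    unfolding m by (rule nested_squares_eq) (use r in simp)
  show ?thesis
  proof (cases "q + r \<le> w")
    case True
    \<comment> \<open>No carry: the two values differ by \<open>2 * q * j\<close>.\<close>
    then obtain j where j: "w = q + r + j" using le_Suc_ex by blast
    have "m = q * w + (q + r)" unfolding m by simp
    then have A: "nested_squares w m
        = q * w * (w + q) + 2 * (q + r) * q + (q + r) * (q + r) + (q + r)"
      using nested_squares_eq[OF True] by simp
    show ?thesis unfolding A B unfolding j by (simp add: algebra_simps)
  next
    case False
    \<comment> \<open>Carry: there are \<open>Suc q\<close> vertices of degree \<open>w\<close> and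
      \<open>u\<close> edges left over. The hypothesis on \<open>m\<close> gives
      \<open>q < w\<close>, so \<open>v\<close> is an honest difference; the two values differ by
      \<open>2 * u * v\<close>.\<close>
    define u v where "u = q + r - w" and "v = w - q - 1"
    have w: "w = q + v + 1" and r': "r = u + v + 1" using False q by (auto simp: u_def v_def)
    have "u \<le> w" using r q by (simp add: u_def)
    moreover have "m = Suc q * w + u" unfolding m using w r' by simp
    ultimately have A: "nested_squares w m
        = Suc q * w * (w + Suc q) + 2 * u * Suc q + u * u + u"
      by (simp only: nested_squares_eq)
    show ?thesis unfolding A B unfolding w r' by (simp add: algebra_simps)
  qed
qed

text \<open>The left side is the trivial bound on the sum of squares when all degrees are at most
  \<open>w\<close>. As the quotient \<open>q\<close> is at least \<open>w\<close>, both
  \<open>Suc w + q \<ge> 2 * w\<close> and \<open>2 * r * q \<ge> 2 * r * w\<close> hold.\<close>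

lemma nested_squares_ge:
  assumes "Suc w * w \<le> m"
  shows "2 * m * w \<le> nested_squares (Suc w) m"
proof -
  define q r where "q = m div Suc w" and "r = m mod Suc w"
  have m: "m = q * Suc w + r" unfolding q_def r_def by (rule div_mult_mod_eq[symmetric])
  have r: "r \<le> Suc w" by (simp add: r_def less_imp_le)
  have "w = (Suc w * w) div Suc w" by (metis nonzero_mult_div_cancel_left nat.distinct(1))
  also have "\<dots> \<le> q" unfolding q_def by (rule div_le_mono) (rule assms)
  finally obtain j where q: "q = w + j" using le_Suc_ex by blast
  show ?thesis
    unfolding m nested_squares_eq[OF r] unfolding q by (simp add: algebra_simps)
qed

text \<open>The measure \<open>card E + w\<close> decreases both when the edges at a vertex of
  degree \<open>w\<close> are deleted and when the bound \<open>w\<close> is lowered. The deleted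
  vertex stays as an isolated one, so \<open>X\<close> and \<open>Y\<close> do not change.\<close>

lemma sum_deg_squares_le:
  assumes "bipartite_edges X Y E" and "\<And>v. v \<in> X \<union> Y \<Longrightarrow> deg E v \<le> w"
  shows "(\<Sum>v\<in>X \<union> Y. (deg E v)\<^sup>2) \<le> nested_squares w (card E)"
  using assms
proof (induction "card E + w" arbitrary: E w rule: less_induct)
  case less
  interpret bipartite_edges X Y E by (rule less.prems)
  show ?case
  proof (cases w)
    case 0
    then show ?thesis using less.prems(2) by simp
  next
    case (Suc w')
    show ?thesis
    proof (cases "\<exists>x\<in>X \<union> Y. deg E x = w")
      case True
      then obtain x where x: "x \<in> X \<union> Y" "deg E x = w" by blast
      define E' where "E' = {d \<in> E. x \<notin> d}"
      have "E = E' \<union> {d \<in> E. x \<in> d}" by (auto simp: E'_def)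
      moreover have "card (E' \<union> {d \<in> E. x \<in> d}) = card E' + card {d \<in> E. x \<in> d}"
        by (rule card_Un_disjoint) (auto simp: E'_def finite_E)
      ultimately have card_E: "card E = card E' + w" using x(2) by (simp add: deg_def)
      have "deg E' v \<le> w" if "v \<in> X \<union> Y" for v
      proof -
        have "deg E' v \<le> deg E v"
          unfolding deg_def by (rule card_mono) (auto simp: finite_E E'_def)
        then show ?thesis using less.prems(2)[OF that] by simp
      qed
      moreover have "bipartite_edges X Y E'" by (rule subset) (auto simp: E'_def)
      moreover have "card E' + w < card E + w" using card_E Suc by simp
      ultimately have "(\<Sum>v\<in>X \<union> Y. (deg E' v)\<^sup>2) \<le> nested_squares w (card E')"
        using less.hyps by blast
      moreover have "(\<Sum>v\<in>X \<union> Y. (deg E v)\<^sup>2) + w \<le>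
          (\<Sum>v\<in>X \<union> Y. (deg E' v)\<^sup>2) + w\<^sup>2 + 2 * card E"
        using x sum_deg_squares_remove[of x]
          bipartite_edges.sum_deg_squares_remove[OF swap, of x]
        by (auto simp: E'_def Un_commute)
      moreover have "nested_squares w (card E) + w
          = nested_squares w (card E') + w\<^sup>2 + 2 * card E"
        using nested_squares_add[of w "card E"] card_E Suc by simp
      ultimately show ?thesis by linarith
    next
      case False
      have deg_le': "deg E v \<le> w'" if "v \<in> X \<union> Y" for v
        using False less.prems(2)[OF that] that Suc by (metis le_SucE)
      show ?thesis
      \<comment> \<open>\<open>nested_squares\<close> need not increase with \<open>w\<close> when
        there are many edges: \<open>nested_squares 1 3 = 12\<close>, but
        \<open>nested_squares 2 3 = 10\<close>. In that range the trivial bound replaces the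
        induction hypothesis.\<close>
      proof (cases "card E < Suc w' * w'")
        case True
        have "(\<Sum>v\<in>X \<union> Y. (deg E v)\<^sup>2) \<le> nested_squares w' (card E)"
          using less.hyps[of E w'] less.prems(1) deg_le' Suc by simp
        also have "\<dots> \<le> nested_squares w (card E)"
          unfolding Suc by (rule nested_squares_mono) (rule True)
        finally show ?thesis .
      next
        case False
        have "(\<Sum>v\<in>X \<union> Y. (deg E v)\<^sup>2) \<le> (\<Sum>v\<in>X \<union> Y. deg E v * w')"
          by (rule sum_mono) (simp add: power2_eq_square deg_le')
        also have "\<dots> = 2 * card E * w'" by (simp add: sum_deg flip: sum_distrib_right)
        also have "\<dots> \<le> nested_squares w (card E)"
          unfolding Suc by (rule nested_squares_ge) (use False in simp)
        finally show ?thesis .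
      qed
    qed
  qed
qed

section \<open>Binomial coefficients as weighted sums of truncated differences\<close>

lemma sum_lessThan_choose: "(\<Sum>c<d. c choose j) = d choose Suc j"
  by (induction d) simp_all

text \<open>Raising \<open>d\<close> by one raises \<open>d - Suc c\<close> by one exactly for
  \<open>c < d\<close>. The weights of these \<open>c\<close> add up to
  \<open>d choose Suc j\<close>, which is the increment in Pascal's rule. The common bound
  \<open>N\<close> gives all degrees the same range of summation.\<close>

lemma choose_eq_sum_diff:
  assumes "d \<le> N"
  shows "d choose Suc (Suc j) = (\<Sum>c<N. (c choose j) * (d - Suc c))"
  using assms
proof (induction d)
  case (Suc d)
  have "(\<Sum>c<N. (c choose j) * (Suc d - Suc c))
      = (\<Sum>c<N. (c choose j) * (d - Suc c) + (if c < d then c choose j else 0))"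
  proof (rule sum.cong)
    fix c
    show "(c choose j) * (Suc d - Suc c)
        = (c choose j) * (d - Suc c) + (if c < d then c choose j else 0)"
    proof (cases "c < d")
      case True
      then have "Suc d - Suc c = Suc (d - Suc c)" by simp
      then show ?thesis using True by (simp only: mult_Suc_right if_True add.commute)
    qed simp
  qed simp
  also have "\<dots> = (\<Sum>c<N. (c choose j) * (d - Suc c)) + (\<Sum>c<d. c choose j)"
  proof -
    have "{..<N} \<inter> {c. c < d} = {..<d}" using Suc.prems by auto
    then show ?thesis by (simp add: sum.distrib sum.If_cases)
  qed
  finally show ?case using Suc by (simp add: sum_lessThan_choose)
qed simp

text \<open>Replacing every weight by the weight \<open>g m\<close> at the crossing can only
  decrease the sum: smaller weights multiply nonpositive terms, larger ones nonnegative
  terms.\<close>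

lemma single_crossing:
  fixes D :: "nat \<Rightarrow> int" and g :: "nat \<Rightarrow> nat"
  assumes "mono g"
    and neg: "\<And>c. c < m \<Longrightarrow> D c \<le> 0" and pos: "\<And>c. m \<le> c \<Longrightarrow> 0 \<le> D c"
    and "0 \<le> (\<Sum>c<N. D c)"
  shows "0 \<le> (\<Sum>c<N. int (g c) * D c)"
proof -
  have "int (g m) * D c \<le> int (g c) * D c" for c
  proof (cases "c < m")
    case True
    then show ?thesis
      using neg[OF True] monoD[OF assms(1), of c m] by (simp add: mult_right_mono_neg)
  next
    case False
    then show ?thesis
      using pos[of c] monoD[OF assms(1), of m c] by (simp add: mult_right_mono)
  qed
  then have "(\<Sum>c<N. int (g m) * D c) \<le> (\<Sum>c<N. int (g c) * D c)"
    by (rule sum_mono)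
  moreover have "0 \<le> (\<Sum>c<N. int (g m) * D c)"
    using assms(4) by (simp flip: sum_distrib_left)
  ultimately show ?thesis by linarith
qed

section \<open>Degree sums of the quasi-complete bipartite graph\<close>

text \<open>The sum of \<open>f\<close> over the degrees of the quasi-complete bipartite graph with sides of
  size \<open>t = Suc s\<close> and \<open>w\<close>, whose picked vertex keeps \<open>r\<close> of its \<open>w\<close> edges.\<close>

definition qc_sum :: "nat \<Rightarrow> nat \<Rightarrow> nat \<Rightarrow> (nat \<Rightarrow> nat) \<Rightarrow> nat" where
  "qc_sum s w r f = s * f w + f r + r * f (Suc s) + (w - r) * f s"

lemma qc_sum_choose:
  assumes "Suc s \<le> r" "r \<le> w" "w \<le> N"
  shows "qc_sum s w r (\<lambda>d. d choose Suc (Suc j))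
    = (\<Sum>c<N. (c choose j) * qc_sum s w r (\<lambda>d. d - Suc c))"
proof -
  have "d choose Suc (Suc j) = (\<Sum>c<N. (c choose j) * (d - Suc c))"
    if "d \<in> {w, r, Suc s, s}" for d
    using that assms by (intro choose_eq_sum_diff) auto
  then show ?thesis
    unfolding qc_sum_def
    by (simp only: insertI1 insertI2 sum_distrib_left sum.distrib distrib_left mult.left_commute)
qed

lemma qc_sum_diff_high:
  assumes "Suc s \<le> c"
  shows "qc_sum s w r (\<lambda>d. d - c) = s * (w - c) + (r - c)"
  using assms by (simp add: qc_sum_def)

text \<open>All degrees \<open>w\<close>, \<open>r\<close>, \<open>Suc s\<close> and
  \<open>s\<close> are at least \<open>c\<close>, so no difference is truncated and the sum is the
  total degree minus \<open>c\<close> per vertex.\<close>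

lemma qc_sum_diff_low:
  assumes "Suc s \<le> r" "r \<le> w" "c \<le> s"
  shows "qc_sum s w r (\<lambda>d. d - c) + c * (Suc s + w) = 2 * (s * w + r)"
proof -
  obtain g where g: "s = c + g" using assms(3) le_Suc_ex by blast
  obtain b where b: "r = Suc s + b" using assms(1) le_Suc_ex by blast
  obtain a where a: "w = r + a" using assms(2) le_Suc_ex by blast
  have *: "s - c = g" "Suc s - c = Suc g" "r - c = Suc g + b" "w - c = Suc g + b + a" "w - r = a"
    using g b a by simp_all
  show ?thesis unfolding qc_sum_def * unfolding a b g by (simp add: algebra_simps)
qed

lemma qc_sum_square:
  assumes "r \<le> w"
  shows "qc_sum s w r (\<lambda>d. d\<^sup>2) = nested_squares w (s * w + r)"
proof -
  obtain a where a: "w = r + a" using assms le_Suc_ex by blast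
  show ?thesis
    unfolding nested_squares_eq[OF assms] qc_sum_def
    unfolding a by (simp add: algebra_simps power2_eq_square)
qed

lemma qc_sum_id:
  assumes "r \<le> w"
  shows "qc_sum s w r (\<lambda>d. d) = 2 * (s * w + r)"
proof -
  obtain a where a: "w = r + a" using assms le_Suc_ex by blast
  show ?thesis unfolding qc_sum_def a by (simp add: algebra_simps)
qed

section \<open>Comparison of a bipartite graph with the quasi-complete one\<close>

lemma two_choose_two: "2 * (d choose 2) + d = d\<^sup>2"
  by (induction d) (simp_all add: power2_eq_square numeral_2_eq_2)

lemma sum_diff_above:
  fixes f :: "'a \<Rightarrow> nat"
  assumes "finite V"
  shows "(\<Sum>v\<in>V. f v - c) + c * card {v \<in> V. c < f v} = (\<Sum>v\<in>{v \<in> V. c < f v}. f v)"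
proof -
  have "(\<Sum>v\<in>V. f v - c) = (\<Sum>v\<in>{v \<in> V. c < f v}. f v - c)"
    by (rule sum.mono_neutral_right) (use assms in auto)
  moreover have "(\<Sum>v\<in>{v \<in> V. c < f v}. f v) = (\<Sum>v\<in>{v \<in> V. c < f v}. (f v - c) + c)"
    by (rule sum.cong) auto
  ultimately show ?thesis by (simp only: sum.distrib sum_constant mult.commute of_nat_id)
qed

lemma sum_diff_Suc:
  fixes f :: "'a \<Rightarrow> nat"
  assumes "finite V"
  shows "(\<Sum>v\<in>V. f v - c) = (\<Sum>v\<in>V. f v - Suc c) + card {v \<in> V. c < f v}"
proof -
  have "(\<Sum>v\<in>V. f v - c) = (\<Sum>v\<in>V. (f v - Suc c) + (if c < f v then 1 else 0))"
    by (rule sum.cong) auto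
  then show ?thesis using assms by (simp add: sum.distrib sum.If_cases Int_def)
qed

context bipartite_edges
begin

text \<open>At most \<open>s\<close> high vertices in \<open>X\<close> are handled by bounding each
  degree by the size of the opposite side; with more, the number of edges is the constraint. The
  right side is the truncated sum of the quasi-complete graph for \<open>c > s\<close>.\<close>

lemma excess_le_if_few_high:
  assumes E: "card E = s * w + r" and XY: "card X + card Y = Suc s + w"
    and X: "Suc s \<le> card X" and Y: "Suc s \<le> card Y" and c: "Suc s \<le> c"
    and QP: "card {y \<in> Y. c < deg E y} \<le> card {x \<in> X. c < deg E x}"
    and Qc: "card {y \<in> Y. c < deg E y} \<le> c"
  shows "(\<Sum>v\<in>X \<union> Y. deg E v - c) \<le> s * (w - c) + (r - c)"
proof -
  define P Q where "P = {x \<in> X. c < deg E x}" and "Q = {y \<in> Y. c < deg E y}"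
  define p q where "p = card P" and "q = card Q"
  have qp: "q \<le> p" and qc: "q \<le> c" using QP Qc by (simp_all add: p_def q_def P_def Q_def)
  have sX: "(\<Sum>v\<in>X. deg E v - c) + c * p = (\<Sum>v\<in>P. deg E v)"
    unfolding p_def P_def by (rule sum_diff_above) (rule finite_X)
  have sY: "(\<Sum>v\<in>Y. deg E v - c) + c * q = (\<Sum>v\<in>Q. deg E v)"
    unfolding q_def Q_def by (rule sum_diff_above) (rule finite_Y)
  show ?thesis
  proof (cases "p \<le> s")
    case True
    have "(\<Sum>v\<in>P. deg E v) \<le> (\<Sum>v\<in>P. card Y)"
      by (rule sum_mono) (auto simp: P_def deg_le)
    then have bX: "(\<Sum>v\<in>X. deg E v - c) + c * p \<le> p * card Y" using sX by (simp add: p_def)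
    have "(\<Sum>v\<in>Q. deg E v) \<le> (\<Sum>v\<in>Q. card X)"
      by (rule sum_mono) (auto simp: Q_def bipartite_edges.deg_le[OF swap])
    then have bY: "(\<Sum>v\<in>Y. deg E v - c) + c * q \<le> q * card X" using sY by (simp add: q_def)
    \<comment> \<open>Without truncation the bounds add up to at most
      \<open>p * (card X + card Y - 2 * c)\<close>, because \<open>q \<le> p\<close>; and
      \<open>card X + card Y - 2 * c \<le> w - c\<close>, because \<open>Suc s \<le> c\<close>. The
      cases deal with truncation.\<close>
    have "(\<Sum>v\<in>X. deg E v - c) + (\<Sum>v\<in>Y. deg E v - c) \<le> p * (w - c)"
    proof (cases "p = 0")
      case True
      then show ?thesis using bX bY qp by simp
    next
      case False
      have "c * p \<le> p * card Y" using bX by linarith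
      then obtain y where y: "card Y = c + y" using False le_Suc_ex by auto
      have X': "(\<Sum>v\<in>X. deg E v - c) \<le> p * y" using bX by (simp add: y algebra_simps)
      show ?thesis
      proof (cases "card X \<le> c")
        case True
        then have "q * card X \<le> c * q" by (simp add: mult.commute)
        then have "(\<Sum>v\<in>Y. deg E v - c) = 0" using bY by linarith
        moreover have "p * y \<le> p * (w - c)" using XY X y by (intro mult_le_mono) auto
        ultimately show ?thesis using X' by linarith
      next
        case False
        then obtain x where x: "card X = c + x" by (metis le_Suc_ex nat_le_linear)
        have "(\<Sum>v\<in>Y. deg E v - c) \<le> q * x" using bY by (simp add: x algebra_simps)
        also have "\<dots> \<le> p * x" using qp by simp
        finally have "(\<Sum>v\<in>X. deg E v - c) + (\<Sum>v\<in>Y. deg E v - c) \<le> p * (y + x)"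
          using X' by (simp add: distrib_left)
        also have "\<dots> \<le> p * (w - c)" using XY c x y by (intro mult_le_mono) auto
        finally show ?thesis .
      qed
    qed
    also have "\<dots> \<le> s * (w - c)" using True by simp
    finally show ?thesis by (simp add: sum_union)
  next
    case False
    have "(\<Sum>v\<in>P. deg E v) + (\<Sum>v\<in>Q. deg E v) \<le> card E + p * q"
      unfolding p_def q_def by (rule sum_deg_two_sides) (auto simp: P_def Q_def)
    then have "(\<Sum>v\<in>X \<union> Y. deg E v - c) + c * p + c * q \<le> s * w + r + p * q"
      using sX sY E by (simp add: sum_union)
    \<comment> \<open>With \<open>p = Suc s + i\<close> the right side minus the left is
      \<open>i * (c - q) + q * (c - Suc s)\<close>.\<close>
    moreover have "p * q + Suc s * c \<le> c * p + c * q"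
    proof -
      obtain i where i: "p = Suc s + i" using False by (metis le_Suc_ex not_less_eq_eq)
      obtain j where j: "c = q + j" using qc le_Suc_ex by blast
      have "i * q + Suc s * q \<le> i * c + c * q"
        using qc c by (intro add_mono mult_le_mono) auto
      then show ?thesis unfolding i by (simp add: algebra_simps)
    qed
    \<comment> \<open>Truncation can only enlarge the right side.\<close>
    moreover have "s * w + r \<le> s * (w - c) + (r - c) + Suc s * c"
    proof -
      have "s * w \<le> s * ((w - c) + c)" by (intro mult_le_mono) auto
      then have "s * w \<le> s * (w - c) + s * c" by (simp add: distrib_left)
      then show ?thesis by simp
    qed
    ultimately show ?thesis by linarith
  qed
qed

lemma sum_deg_choose_le:
  assumes E: "card E = s * w + r" and XY: "card X + card Y = Suc s + w"
    and X: "Suc s \<le> card X" and Y: "Suc s \<le> card Y" and r: "Suc s \<le> r" "r \<le> w"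
  shows "(\<Sum>v\<in>X \<union> Y. deg E v choose Suc (Suc j))
    \<le> qc_sum s w r (\<lambda>d. d choose Suc (Suc j))"
proof -
  define T where "T c = (\<Sum>v\<in>X \<union> Y. deg E v - c)" for c
  define U where "U c = qc_sum s w r (\<lambda>d. d - c)" for c
  define D where "D c = int (U c) - int (T c)" for c
  define p q where "p c = card {x \<in> X. c < deg E x}" and "q c = card {y \<in> Y. c < deg E y}" for c
  \<comment> \<open>The opposite side has at most \<open>w\<close> vertices, since each side has at
    least \<open>Suc s\<close>.\<close>
  have deg_w: "deg E v \<le> w" if "v \<in> X \<union> Y" for v
    using that deg_le[of v] bipartite_edges.deg_le[OF swap, of v] XY X Y by auto
  have low: "D c \<le> 0" if "c \<le> s" for c
  proof -
    have "2 * card E = (\<Sum>v\<in>X \<union> Y. deg E v)" by (simp add: sum_deg)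
    also have "\<dots> \<le> (\<Sum>v\<in>X \<union> Y. (deg E v - c) + c)" by (rule sum_mono) simp
    also have "\<dots> = T c + c * (card X + card Y)"
      by (simp add: T_def sum.distrib card_Un_disjoint finite_X finite_Y disjoint)
    finally have "2 * (s * w + r) \<le> T c + c * (Suc s + w)" by (simp add: E XY)
    then show ?thesis using qc_sum_diff_low[OF r that] by (simp add: D_def U_def)
  qed
  have high: "0 \<le> D c" if c: "Suc s \<le> c" and pq: "min (p c) (q c) \<le> c" for c
  proof (cases "q c \<le> p c")
    case True
    then have "T c \<le> U c"
      using excess_le_if_few_high[OF E XY X Y c] pq c
      by (simp add: T_def U_def p_def q_def qc_sum_diff_high)
    then show ?thesis by (simp add: D_def)
  next
    case False
    then have "T c \<le> U c"
      using bipartite_edges.excess_le_if_few_high[OF swap E _ Y X c] pq c XY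
      by (simp add: T_def U_def p_def q_def qc_sum_diff_high Un_commute add.commute)
    then show ?thesis by (simp add: D_def)
  qed
  have step: "0 \<le> D (Suc c)" if c: "Suc s \<le> c" and D: "0 \<le> D c" for c
  proof (cases "min (p c) (q c) \<le> c")
    case True
    have "p (Suc c) \<le> p c" "q (Suc c) \<le> q c"
      unfolding p_def q_def using finite_X finite_Y by (auto intro!: card_mono)
    then show ?thesis using high[of "Suc c"] c True by simp
  next
    case False
    \<comment> \<open>Here \<open>T\<close> drops by \<open>p c + q c > 2 * c\<close>, while
      \<open>U\<close> drops by at most \<open>Suc s \<le> c\<close>.\<close>
    have "T c = T (Suc c) + card {v \<in> X \<union> Y. c < deg E v}"
      unfolding T_def by (rule sum_diff_Suc) (simp add: finite_X finite_Y)
    moreover have "{v \<in> X \<union> Y. c < deg E v} = {x \<in> X. c < deg E x} \<union> {y \<in> Y. c < deg E y}"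
      by blast
    moreover have "card ({x \<in> X. c < deg E x} \<union> {y \<in> Y. c < deg E y}) = p c + q c"
      unfolding p_def q_def
      by (rule card_Un_disjoint) (use finite_X finite_Y disjoint in auto)
    ultimately have "T c = T (Suc c) + p c + q c" by simp
    moreover have "U c \<le> U (Suc c) + Suc s"
    proof -
      have "s * (w - c) \<le> s * Suc (w - Suc c)" by (intro mult_le_mono) auto
      then show ?thesis unfolding U_def using c by (simp add: qc_sum_diff_high)
    qed
    ultimately show ?thesis using D False c by (simp add: D_def)
  qed
  define N where "N = Suc s + w"
  have T0: "T c = 0" if "w \<le> c" for c
    unfolding T_def by (rule sum.neutral) (use deg_w that order_trans in force)
  \<comment> \<open>The crossing is sought only above \<open>s\<close>: up to \<open>s\<close>,
    \<open>low\<close> gives the sign; beyond, minimality does below \<open>m\<close> and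
    \<open>step\<close> does from \<open>m\<close> on.\<close>
  define m where "m = (LEAST c. Suc s \<le> c \<and> 0 \<le> D c)"
  have ex: "Suc s \<le> N \<and> 0 \<le> D N" using T0[of N] by (simp add: N_def D_def)
  have m: "Suc s \<le> m \<and> 0 \<le> D m" unfolding m_def by (rule LeastI) (rule ex)
  have below: "D c \<le> 0" if "c < m" for c
    using low[of c] not_less_Least[of c "\<lambda>c. Suc s \<le> c \<and> 0 \<le> D c"] that
    unfolding m_def by linarith
  have above: "0 \<le> D c" if "m \<le> c" for c
    using that by (induction c rule: dec_induct) (use m step in auto)
  have choose: "int (qc_sum s w r (\<lambda>d. d choose Suc (Suc i)))
      - int (\<Sum>v\<in>X \<union> Y. deg E v choose Suc (Suc i))
      = (\<Sum>c<N. int (c choose i) * D (Suc c))" for i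
  proof -
    have "(\<Sum>v\<in>X \<union> Y. deg E v choose Suc (Suc i))
        = (\<Sum>v\<in>X \<union> Y. \<Sum>c<N. (c choose i) * (deg E v - Suc c))"
      by (intro sum.cong refl choose_eq_sum_diff) (auto simp: N_def intro: deg_w le_SucI trans_le_add2)
    also have "\<dots> = (\<Sum>c<N. (c choose i) * T (Suc c))"
      unfolding T_def by (subst sum.swap) (simp add: sum_distrib_left)
    finally have "(\<Sum>v\<in>X \<union> Y. deg E v choose Suc (Suc i)) = (\<Sum>c<N. (c choose i) * T (Suc c))" .
    moreover have "qc_sum s w r (\<lambda>d. d choose Suc (Suc i)) = (\<Sum>c<N. (c choose i) * U (Suc c))"
      unfolding U_def by (rule qc_sum_choose) (use r in \<open>auto simp: N_def\<close>)
    ultimately show ?thesis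
      by (simp add: D_def right_diff_distrib sum_subtractf)
  qed
  have "(\<Sum>v\<in>X \<union> Y. deg E v choose 2) \<le> qc_sum s w r (\<lambda>d. d choose 2)"
  proof -
    have "(\<Sum>v\<in>X \<union> Y. (deg E v)\<^sup>2) \<le> qc_sum s w r (\<lambda>d. d\<^sup>2)"
      unfolding qc_sum_square[OF r(2)] E[symmetric]
      by (rule sum_deg_squares_le) (use bipartite_edges_axioms deg_w in auto)
    moreover have "(\<Sum>v\<in>X \<union> Y. (deg E v)\<^sup>2)
        = 2 * (\<Sum>v\<in>X \<union> Y. deg E v choose 2) + 2 * card E"
      by (simp only: two_choose_two[symmetric] sum.distrib sum_distrib_left sum_deg)
    moreover have "qc_sum s w r (\<lambda>d. d\<^sup>2)
        = 2 * qc_sum s w r (\<lambda>d. d choose 2) + qc_sum s w r (\<lambda>d. d)"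
      unfolding two_choose_two[symmetric] by (simp add: qc_sum_def algebra_simps)
    ultimately show ?thesis using qc_sum_id[OF r(2), of s] E by simp
  qed
  then have "0 \<le> int (qc_sum s w r (\<lambda>d. d choose 2)) - int (\<Sum>v\<in>X \<union> Y. deg E v choose 2)"
    by linarith
  \<comment> \<open>The identity \<open>choose\<close> with \<open>i = 0\<close> has all weights
    equal to 1, so the case of squares is the unweighted sum.\<close>
  then have "0 \<le> (\<Sum>c<N. D (Suc c))"
    unfolding numeral_2_eq_2 choose by simp
  then have "0 \<le> (\<Sum>c<N. int (c choose j) * D (Suc c))"
    \<comment> \<open>The summands are \<open>D (Suc c)\<close>, hence the shift of the crossing by
      one.\<close>
    by (intro single_crossing[where m = "m - 1"])
      (use m below above in \<open>auto simp: mono_def binomial_right_mono\<close>)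
  then show ?thesis using choose[of j] by linarith
qed

end

section \<open>Copies of stars counted by edge sets and by degrees\<close>

text \<open>Stars with at least one edge have no isolated vertices, so the edges determine the
  vertex set. For \<open>k = 0\<close> the star is a single vertex, which is not the union of its
  edges.\<close>

lemma star_iso_iff:
  assumes k: "1 \<le> k" and F: "\<forall>d\<in>F. card d = 2" "finite W" "\<forall>d\<in>F. d \<subseteq> W"
  shows "isomorphic_graphs (W, F) (star k) \<longleftrightarrow>
    W = \<Union>F \<and> card F = k \<and> (\<exists>v. \<forall>d\<in>F. v \<in> d)"
proof
  assume "isomorphic_graphs (W, F) (star k)"
  then obtain f where f: "bij_betw f W {0..k}"
    and edges: "{{0, i} | i. i \<in> {1..k}} = (\<lambda>d. f ` d) ` F"
    by (auto simp: isomorphic_graphs_def star_def)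
  have inj: "inj_on f W" using f by (rule bij_betw_imp_inj_on)
  have "0 \<in> f ` W" using f by (simp add: bij_betw_def)
  then obtain v where v: "v \<in> W" "f v = 0" by auto
  have v_edge: "v \<in> d" if d: "d \<in> F" for d
  proof -
    have "f ` d \<in> {{0, i} | i. i \<in> {1..k}}" unfolding edges using d by blast
    then have "0 \<in> f ` d" by auto
    then obtain u where u: "u \<in> d" "f u = 0" by auto
    then have "u = v" using inj_onD[OF inj, of u v] v d F(3) by auto
    then show ?thesis using u by simp
  qed
  have "card F = k"
  proof -
    have "inj_on (\<lambda>d. f ` d) F"
      using inj F(3) by (auto simp: inj_on_def inj_on_image_eq_iff[OF inj])
    then have "card F = card {{0, i} | i. i \<in> {1..k}}"
      unfolding edges by (simp add: card_image)
    also have "{{0, i} | i. i \<in> {1..k}} = (\<lambda>i. {0, i}) ` {1..k}" by blast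
    also have "card \<dots> = k"
      by (subst card_image) (auto simp: inj_on_def doubleton_eq_iff)
    finally show ?thesis .
  qed
  moreover have "W \<subseteq> \<Union>F"
  proof
    fix u assume u: "u \<in> W"
    show "u \<in> \<Union>F"
    proof (cases "f u = 0")
      case True
      then have "u = v" using inj_onD[OF inj, of u v] u v by simp
      moreover have "F \<noteq> {}" using \<open>card F = k\<close> k by auto
      ultimately show ?thesis using v_edge by blast
    next
      case False
      have "f u \<in> {0..k}" using bij_betw_apply[OF f u] .
      then have "{0, f u} \<in> (\<lambda>d. f ` d) ` F" unfolding edges[symmetric] using False by force
      then obtain d where d: "d \<in> F" "f ` d = {0, f u}" by auto
      then have "f u \<in> f ` d" by simp
      then obtain u' where "u' \<in> d" "f u' = f u" by auto
      then have "u' = u" using inj_onD[OF inj, of u' u] u d(1) F(3) by auto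
      then show ?thesis using d(1) \<open>u' \<in> d\<close> by blast
    qed
  qed
  ultimately show "W = \<Union>F \<and> card F = k \<and> (\<exists>v. \<forall>d\<in>F. v \<in> d)"
    using F(3) v_edge by blast
next
  assume "W = \<Union>F \<and> card F = k \<and> (\<exists>v. \<forall>d\<in>F. v \<in> d)"
  then obtain v where W: "W = \<Union>F" and card: "card F = k" and v: "\<forall>d\<in>F. v \<in> d" by blast
  define S where "S = W - {v}"
  have pair: "\<exists>s\<in>S. d = {v, s}" if d: "d \<in> F" for d
  proof -
    obtain a b where ab: "d = {a, b}" "a \<noteq> b" using F(1) d by (meson card_2_iff)
    moreover have "v \<in> d" using v d by blast
    ultimately obtain s where "d = {v, s}" "s \<noteq> v" by blast
    then show ?thesis using d W by (auto simp: S_def)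
  qed
  have star_F: "F = (\<lambda>s. {v, s}) ` S"
  proof
    show "F \<subseteq> (\<lambda>s. {v, s}) ` S" using pair by blast
    show "(\<lambda>s. {v, s}) ` S \<subseteq> F"
    proof
      fix d assume "d \<in> (\<lambda>s. {v, s}) ` S"
      then obtain s where s: "s \<in> S" "d = {v, s}" by blast
      then obtain d' where d': "d' \<in> F" "s \<in> d'" using W by (auto simp: S_def)
      moreover obtain s' where "d' = {v, s'}" using pair[OF d'(1)] by blast
      ultimately show "d \<in> F" using s by (auto simp: S_def)
    qed
  qed
  have "inj_on (\<lambda>s. {v, s}) S" by (auto simp: inj_on_def doubleton_eq_iff)
  then have "card S = k" using card unfolding star_F by (simp add: card_image)
  moreover have "finite S" using F(2) by (simp add: S_def)
  ultimately obtain h where h: "bij_betw h S {1..k}"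
    by (metis card_atLeastAtMost diff_Suc_1 finite_atLeastAtMost finite_same_card_bij)
  \<comment> \<open>The centre goes to 0 and the leaves follow a bijection onto
    \<open>{1..k}\<close>.\<close>
  define f where "f u = (if u = v then 0 else h u)" for u
  have fS: "f s = h s" if "s \<in> S" for s using that by (simp add: f_def S_def)
  have "v \<in> W" using k card v W by (metis card.empty ex_in_conv not_one_le_zero UnionI)
  then have WS: "W = insert v S" by (auto simp: S_def)
  have "bij_betw f S {1..k}" using h bij_betw_cong[of S f h] fS by blast
  moreover have "bij_betw f {v} {0}" by (simp add: f_def)
  ultimately have "bij_betw f ({v} \<union> S) ({0} \<union> {1..k})"
    by (intro bij_betw_combine) auto
  moreover have "{0} \<union> {1..k} = {0..k}" by auto
  ultimately have "bij_betw f W {0..k}" by (simp add: WS)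
  moreover have "{{0, i} | i. i \<in> {1..k}} = (\<lambda>d. f ` d) ` F"
  proof -
    have "(\<lambda>d. f ` d) ` F = (\<lambda>s. {0, h s}) ` S"
      unfolding star_F image_image by (rule image_cong) (auto simp: f_def S_def)
    also have "\<dots> = (\<lambda>i. {0, i}) ` (h ` S)" by (simp add: image_image)
    also have "h ` S = {1..k}" using h by (simp add: bij_betw_def)
    finally show ?thesis unfolding Setcompr_eq_image by (rule sym)
  qed
  ultimately show "isomorphic_graphs (W, F) (star k)"
    by (auto simp: isomorphic_graphs_def star_def)
qed

lemma num_copies_star:
  assumes G: "finite_simple_graph G" and k: "1 \<le> k"
  shows "num_copies (star k) G = card {F. F \<subseteq> edges G \<and> card F = k \<and> (\<exists>v. \<forall>d\<in>F. v \<in> d)}"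
proof -
  let ?S = "{F. F \<subseteq> edges G \<and> card F = k \<and> (\<exists>v. \<forall>d\<in>F. v \<in> d)}"
  have "{H. subgraph_of H G \<and> isomorphic_graphs H (star k)} = (\<lambda>F. (\<Union>F, F)) ` ?S"
  proof (intro equalityI subsetI)
    fix H assume "H \<in> {H. subgraph_of H G \<and> isomorphic_graphs H (star k)}"
    moreover obtain W F where "H = (W, F)" by fastforce
    ultimately show "H \<in> (\<lambda>F. (\<Union>F, F)) ` ?S"
      using star_iso_iff[OF k, of F W] by (auto simp: subgraph_of_def finite_simple_graph_def)
  next
    fix H assume "H \<in> (\<lambda>F. (\<Union>F, F)) ` ?S"
    then obtain F where H: "H = (\<Union>F, F)" and F: "F \<subseteq> edges G" "card F = k" "\<exists>v. \<forall>d\<in>F. v \<in> d"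
      by blast
    have sub: "\<Union>F \<subseteq> verts G" and two: "\<forall>d\<in>F. card d = 2"
      using F(1) G unfolding finite_simple_graph_def by blast+
    have fin: "finite (\<Union>F)" using sub G by (auto simp: finite_simple_graph_def intro: finite_subset)
    show "H \<in> {H. subgraph_of H G \<and> isomorphic_graphs H (star k)}"
      using star_iso_iff[OF k two fin] F sub two fin
      by (auto simp: H subgraph_of_def finite_simple_graph_def)
  qed
  moreover have "inj_on (\<lambda>F. (\<Union>F, F)) ?S" by (auto simp: inj_on_def)
  ultimately show ?thesis by (simp add: num_copies_def card_image)
qed

text \<open>Both ends of a single edge serve as its centre, so the degree sum would count each copy
  twice; hence the separate case.\<close>

lemma num_copies_star_1:
  assumes G: "finite_simple_graph G"
  shows "num_copies (star 1) G = card (edges G)"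
proof -
  have "{F. F \<subseteq> edges G \<and> card F = 1 \<and> (\<exists>v. \<forall>d\<in>F. v \<in> d)} = (\<lambda>d. {d}) ` edges G"
  proof (intro equalityI subsetI)
    fix F assume "F \<in> {F. F \<subseteq> edges G \<and> card F = 1 \<and> (\<exists>v. \<forall>d\<in>F. v \<in> d)}"
    then show "F \<in> (\<lambda>d. {d}) ` edges G" by (auto simp: card_1_singleton_iff)
  next
    fix F assume "F \<in> (\<lambda>d. {d}) ` edges G"
    then obtain d where d: "F = {d}" "d \<in> edges G" by blast
    then have "card d = 2" using G by (simp add: finite_simple_graph_def)
    then have "d \<noteq> {}" by auto
    then show "F \<in> {F. F \<subseteq> edges G \<and> card F = 1 \<and> (\<exists>v. \<forall>d\<in>F. v \<in> d)}" using d by auto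
  qed
  moreover have "card ((\<lambda>d. {d}) ` edges G) = card (edges G)" by (rule card_image) simp
  ultimately show ?thesis using num_copies_star[OF G, of 1] by simp
qed

text \<open>With two or more edges the centre is unique: edges sharing two vertices coincide. Copies
  can therefore be sorted by their centre, and each is a choice of \<open>k\<close> edges
  there.\<close>

lemma num_copies_star_ge_2:
  assumes G: "finite_simple_graph G" and k: "2 \<le> k"
  shows "num_copies (star k) G = (\<Sum>v\<in>verts G. deg (edges G) v choose k)"
proof -
  let ?A = "\<lambda>v. {F. F \<subseteq> {d \<in> edges G. v \<in> d} \<and> card F = k}"
  have fin_V: "finite (verts G)" and in_V: "\<And>d. d \<in> edges G \<Longrightarrow> d \<subseteq> verts G"
    and two: "\<And>d. d \<in> edges G \<Longrightarrow> card d = 2"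
    using G by (auto simp: finite_simple_graph_def)
  have "edges G \<subseteq> Pow (verts G)" using in_V by blast
  then have fin_E: "finite (edges G)" by (rule finite_subset) (simp add: fin_V)
  have disj: "?A u \<inter> ?A v = {}" if "u \<noteq> v" for u v
  proof (rule ccontr)
    assume "?A u \<inter> ?A v \<noteq> {}"
    then obtain F where F: "F \<subseteq> edges G" "\<forall>d\<in>F. u \<in> d \<and> v \<in> d" "card F = k" by blast
    have "d = {u, v}" if d: "d \<in> F" for d
    proof (rule sym, rule card_subset_eq)
      have "card d = 2" using two F(1) d by blast
      then show "finite d" "card {u, v} = card d"
        using \<open>u \<noteq> v\<close> card.infinite[of d] by fastforce+
    qed (use F(2) d in blast)
    then have "F \<subseteq> {{u, v}}" by blast
    then have "card F \<le> card {{u, v}}" by (intro card_mono) auto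
    then show False using F(3) k by simp
  qed
  have "{F. F \<subseteq> edges G \<and> card F = k \<and> (\<exists>v. \<forall>d\<in>F. v \<in> d)} = (\<Union>v\<in>verts G. ?A v)"
  proof (intro equalityI subsetI)
    fix F assume "F \<in> {F. F \<subseteq> edges G \<and> card F = k \<and> (\<exists>v. \<forall>d\<in>F. v \<in> d)}"
    then obtain v where F: "F \<subseteq> edges G" "card F = k" "\<forall>d\<in>F. v \<in> d" by blast
    moreover have "F \<noteq> {}" using F(2) k by auto
    ultimately show "F \<in> (\<Union>v\<in>verts G. ?A v)" using in_V by blast
  qed blast
  then have "num_copies (star k) G = card (\<Union>v\<in>verts G. ?A v)"
    using num_copies_star[OF G] k by simp
  also have "\<dots> = (\<Sum>v\<in>verts G. card (?A v))"
    using disj by (intro card_UN_disjoint) (auto simp: fin_V fin_E)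
  also have "\<dots> = (\<Sum>v\<in>verts G. deg (edges G) v choose k)"
    using fin_E by (simp add: deg_def n_subsets)
  finally show ?thesis .
qed

section \<open>Bipartitions and the shape of the quasi-complete graph\<close>

lemma bipartite_edges_imp_graph:
  assumes "bipartite_edges X Y (edges G)" and "verts G = X \<union> Y"
  shows "bipartite_graph G"
proof -
  interpret bipartite_edges X Y "edges G" by (rule assms(1))
  have "d \<subseteq> verts G \<and> card d = 2" if d: "d \<in> edges G" for d
    using edge[OF d] disjoint assms(2) card_2_iff by fastforce
  then have "finite_simple_graph G"
    using assms(2) finite_X finite_Y by (simp add: finite_simple_graph_def)
  moreover have "X \<union> Y = verts G \<and> X \<inter> Y = {} \<and> (\<forall>d\<in>edges G. \<exists>x\<in>X. \<exists>y\<in>Y. d = {x, y})"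
    using assms(2) disjoint edge by simp
  ultimately show ?thesis unfolding bipartite_graph_def
    by (intro conjI[of "finite_simple_graph G"] exI)
qed

lemma bipartite_graph_imp_edges:
  assumes "bipartite_graph G"
  obtains X Y where "bipartite_edges X Y (edges G)" and "verts G = X \<union> Y"
proof -
  have "\<exists>X Y. X \<union> Y = verts G \<and> X \<inter> Y = {} \<and> (\<forall>d\<in>edges G. \<exists>x\<in>X. \<exists>y\<in>Y. d = {x, y})"
    using assms by (simp add: bipartite_graph_def)
  then obtain X Y where XY: "X \<union> Y = verts G \<and> X \<inter> Y = {} \<and>
      (\<forall>d\<in>edges G. \<exists>x\<in>X. \<exists>y\<in>Y. d = {x, y})"
    by (elim exE) (rule that)
  moreover have "finite (verts G)"
    using assms by (simp add: bipartite_graph_def finite_simple_graph_def)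
  ultimately have "finite X" "finite Y" by (metis finite_Un)+
  then have "bipartite_edges X Y (edges G)" using XY by unfold_locales auto
  then show ?thesis using that XY by metis
qed

text \<open>Half of \<open>n\<close>, rounded down, is a candidate for the least size. Minimality of
  \<open>Suc s\<close> gives \<open>s * (n - s) < e\<close>, which is exactly
  \<open>Suc s \<le> r\<close>: the picked vertex keeps at least \<open>Suc s\<close> edges.\<close>

lemma qcb_size_bounds:
  assumes e: "0 < e" and le: "real e \<le> (real n)\<^sup>2 / 4"
  obtains s r where "qcb_size n e = Suc s" and "e = s * (n - Suc s) + r"
    and "Suc s \<le> r" and "r \<le> n - Suc s" and "Suc s \<le> n"
proof -
  let ?P = "\<lambda>i. 0 < i \<and> e \<le> i * (n - i)"
  define h where "h = n div 2"
  have "real (4 * e) \<le> real (n\<^sup>2)" using le by simp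
  then have e4: "4 * e \<le> n\<^sup>2" by (simp only: of_nat_le_iff)
  have n: "n = 2 * h \<or> n = 2 * h + 1" by (auto simp: h_def)
  then have eh: "e \<le> h * (n - h)"
  proof
    assume n: "n = 2 * h"
    show ?thesis using e4 by (simp add: n power2_eq_square)
  next
    assume n: "n = 2 * h + 1"
    \<comment> \<open>For odd \<open>n\<close> integrality absorbs the extra 1.\<close>
    have "4 * e \<le> 4 * (h * (h + 1)) + 1" using e4 by (simp add: n power2_eq_square algebra_simps)
    then show ?thesis by (simp add: n algebra_simps)
  qed
  then have "0 < h" using e by (cases h) auto
  then have Ph: "?P h" using eh by simp
  have P: "?P (qcb_size n e)" unfolding qcb_size_def by (rule LeastI) (rule Ph)
  have "qcb_size n e \<le> h" unfolding qcb_size_def by (rule Least_le) (rule Ph)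
  moreover obtain s where s: "qcb_size n e = Suc s" using P by (cases "qcb_size n e") auto
  ultimately have sn: "2 * Suc s \<le> n" using n by auto
  obtain w where w: "n = Suc s + w" using sn le_Suc_ex[of "Suc s" n] by auto
  have upper: "e \<le> s * w + w" using P unfolding s by (simp add: w)
  have lower: "s * w + s < e"
  \<comment> \<open>The least size is taken among positive numbers, so minimality says nothing about
    \<open>s = 0\<close>; there \<open>0 < e\<close> suffices.\<close>
  proof (cases "s = 0")
    case False
    have "\<not> ?P s"
      by (rule not_less_Least) (use s in \<open>simp add: qcb_size_def\<close>)
    then show ?thesis using False by (simp add: w)
  qed (use e in simp)
  show ?thesis
  proof (rule that)
    show "e = s * (n - Suc s) + (e - s * w)" using lower by (simp add: w)
  qed (use upper lower s sn w in auto)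
qed

text \<open>Describing edges by a relation between disjoint sides turns degrees into sizes of its
  sections.\<close>

lemma pair_image_deg:
  assumes "R \<subseteq> X \<times> Y" and "X \<inter> Y = {}"
  shows "x \<in> X \<Longrightarrow> deg ((\<lambda>(x, y). {x, y}) ` R) x = card {y. (x, y) \<in> R}"
    and "y \<in> Y \<Longrightarrow> deg ((\<lambda>(x, y). {x, y}) ` R) y = card {x. (x, y) \<in> R}"
proof -
  assume x: "x \<in> X"
  have "{d \<in> (\<lambda>(x, y). {x, y}) ` R. x \<in> d} = (\<lambda>y. {x, y}) ` {y. (x, y) \<in> R}"
    using assms x by (fastforce simp: image_iff)
  moreover have "inj_on (\<lambda>y. {x, y}) {y. (x, y) \<in> R}" by (auto simp: inj_on_def doubleton_eq_iff)
  ultimately show "deg ((\<lambda>(x, y). {x, y}) ` R) x = card {y. (x, y) \<in> R}"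
    by (simp add: deg_def card_image)
next
  assume y: "y \<in> Y"
  have "{d \<in> (\<lambda>(x, y). {x, y}) ` R. y \<in> d} = (\<lambda>x. {x, y}) ` {x. (x, y) \<in> R}"
    using assms y by (fastforce simp: image_iff)
  moreover have "inj_on (\<lambda>x. {x, y}) {x. (x, y) \<in> R}" by (auto simp: inj_on_def doubleton_eq_iff)
  ultimately show "deg ((\<lambda>(x, y). {x, y}) ` R) y = card {x. (x, y) \<in> R}"
    by (simp add: deg_def card_image)
qed

lemma quasi_complete_bipartite_degrees:
  assumes t: "qcb_size n e = Suc s" and n: "n = Suc s + w" and e: "e = s * w + r"
    and r: "r \<le> w"
  defines "X \<equiv> {..<Suc s}" and "Y \<equiv> {Suc s..<n}" and "B \<equiv> quasi_complete_bipartite n e"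
  shows "verts B = X \<union> Y" and "bipartite_edges X Y (edges B)" and "card (edges B) = e"
    and "(\<Sum>v\<in>verts B. f (deg (edges B) v)) = qc_sum s w r f"
proof -
  \<comment> \<open>The pairs kept as edges: vertex 0 loses its first \<open>w - r\<close>
    neighbours.\<close>
  define R where "R = X \<times> Y - {0} \<times> {Suc s..<Suc s + (w - r)}"
  have m: "Suc s * (n - Suc s) - e = w - r" by (simp add: n e)
  have disj: "X \<inter> Y = {}" by (auto simp: X_def Y_def)
  have V: "verts B = {..<n}"
    unfolding B_def quasi_complete_bipartite_def t Let_def using n by (simp add: complete_bipartite_def)
  have E: "edges B = (\<lambda>(x, y). {x, y}) ` R"
  proof -
    have "edges B = {{x, y} | x y. x \<in> X \<and> y \<in> Y} - {{0, y} | y. y \<in> {Suc s..<Suc s + (w - r)}}"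
      unfolding B_def quasi_complete_bipartite_def t Let_def m X_def Y_def
      using n by (simp add: complete_bipartite_def)
    also have "\<dots> = (\<lambda>(x, y). {x, y}) ` R"
    proof (intro equalityI subsetI)
      fix d assume "d \<in> {{x, y} | x y. x \<in> X \<and> y \<in> Y} - {{0, y} | y. y \<in> {Suc s..<Suc s + (w - r)}}"
      then obtain x y where d: "d = {x, y}" "x \<in> X" "y \<in> Y"
        and no: "d \<notin> {{0, y} | y. y \<in> {Suc s..<Suc s + (w - r)}}" by blast
      have "\<not> (x = 0 \<and> y \<in> {Suc s..<Suc s + (w - r)})" using no d(1) by blast
      then have "(x, y) \<in> R" using d by (auto simp: R_def)
      then show "d \<in> (\<lambda>(x, y). {x, y}) ` R" using d(1) by force
    next
      fix d assume "d \<in> (\<lambda>(x, y). {x, y}) ` R"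
      then obtain x y where d: "d = {x, y}" "(x, y) \<in> R" by auto
      moreover from d(2) have xy: "x \<in> X" "y \<in> Y" by (simp_all add: R_def)
      \<comment> \<open>Deleting unordered edges agrees with deleting ordered pairs because 0 and
        \<open>z\<close> lie on different sides.\<close>
      moreover have "d \<noteq> {0, z}" if "z \<in> {Suc s..<Suc s + (w - r)}" for z
      proof
        assume "d = {0, z}"
        then have "x = 0 \<and> y = z" using d(1) xy that by (auto simp: doubleton_eq_iff X_def Y_def)
        then show False using d(2) that by (simp add: R_def)
      qed
      ultimately show "d \<in> {{x, y} | x y. x \<in> X \<and> y \<in> Y} - {{0, y} | y. y \<in> {Suc s..<Suc s + (w - r)}}"
        by blast
    qed
    finally show ?thesis .
  qed
  have R: "R \<subseteq> X \<times> Y" by (auto simp: R_def)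
  show VXY: "verts B = X \<union> Y"
  proof -
    have "Suc s \<le> n" using n by simp
    then show ?thesis unfolding V X_def Y_def by auto
  qed
  show bip: "bipartite_edges X Y (edges B)"
  proof
    show "finite X" "finite Y" "X \<inter> Y = {}" using disj by (simp_all add: X_def Y_def)
    show "\<exists>x\<in>X. \<exists>y\<in>Y. d = {x, y}" if "d \<in> edges B" for d
      using that R unfolding E by auto
  qed
  interpret bipartite_edges X Y "edges B" by (rule bip)
  have degX: "deg (edges B) x = (if x = 0 then r else w)" if x: "x \<in> X" for x
  proof -
    have "{y. (x, y) \<in> R} = (if x = 0 then {Suc s + (w - r)..<n} else {Suc s..<n})"
      using x n by (auto simp: R_def X_def Y_def)
    then show ?thesis unfolding E pair_image_deg(1)[OF R disj x] using n r by simp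
  qed
  have degY: "deg (edges B) y = (if y < Suc s + (w - r) then s else Suc s)" if y: "y \<in> Y" for y
  proof -
    have "{x. (x, y) \<in> R} = (if y < Suc s + (w - r) then {1..<Suc s} else {..<Suc s})"
      using y n by (auto simp: R_def X_def Y_def)
    then show ?thesis unfolding E pair_image_deg(2)[OF R disj y] by simp
  qed
  have sum_X: "(\<Sum>v\<in>X. g (deg (edges B) v)) = g r + s * g w" for g :: "nat \<Rightarrow> nat"
  proof -
    have "(\<Sum>v\<in>X. g (deg (edges B) v)) = (\<Sum>v<Suc s. g (if v = 0 then r else w))"
      by (rule sum.cong) (simp_all add: X_def degX)
    then show ?thesis by (simp add: sum.lessThan_Suc_shift del: sum.lessThan_Suc)
  qed
  have sum_Y: "(\<Sum>v\<in>Y. g (deg (edges B) v)) = (w - r) * g s + r * g (Suc s)" for g :: "nat \<Rightarrow> nat"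
  proof -
    have "Y = {Suc s..<Suc s + (w - r)} \<union> {Suc s + (w - r)..<n}" using n by (auto simp: Y_def)
    then have "(\<Sum>v\<in>Y. g (deg (edges B) v)) = (\<Sum>v\<in>{Suc s..<Suc s + (w - r)}. g (deg (edges B) v))
        + (\<Sum>v\<in>{Suc s + (w - r)..<n}. g (deg (edges B) v))"
      by (simp add: sum.union_disjoint)
    also have "(\<Sum>v\<in>{Suc s..<Suc s + (w - r)}. g (deg (edges B) v)) = (\<Sum>v\<in>{Suc s..<Suc s + (w - r)}. g s)"
      using n by (intro sum.cong) (auto simp: degY Y_def)
    also have "(\<Sum>v\<in>{Suc s + (w - r)..<n}. g (deg (edges B) v)) = (\<Sum>v\<in>{Suc s + (w - r)..<n}. g (Suc s))"
      using n by (intro sum.cong) (auto simp: degY Y_def)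
    finally show ?thesis using n r by simp
  qed
  show "card (edges B) = e" using sum_deg_X sum_X[of "\<lambda>d. d"] e by simp
  show "(\<Sum>v\<in>verts B. f (deg (edges B) v)) = qc_sum s w r f"
    unfolding VXY sum_union sum_X sum_Y by (simp add: qc_sum_def)
qed

section \<open>The maximum over all bipartite graphs\<close>

theorem theorem1p3:
  fixes k n e :: nat
  assumes "k \<ge> 1" and "n > 0" and "e > 0"
    and "real e \<le> (real n)\<^sup>2 / 4"
  shows "ex_bip n e (star k) = num_copies (star k) (quasi_complete_bipartite n e)"
proof -
  obtain s r where t: "qcb_size n e = Suc s" and e: "e = s * (n - Suc s) + r"
    and r: "Suc s \<le> r" "r \<le> n - Suc s" and sn: "Suc s \<le> n"
    using qcb_size_bounds[OF assms(3,4)] .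
  define w where "w = n - Suc s"
  have n: "n = Suc s + w" using sn by (simp add: w_def)
  note e = e[folded w_def] and r = r[folded w_def]
  define K where "K = quasi_complete_bipartite n e"
  note K = quasi_complete_bipartite_degrees[OF t n e r(2), folded K_def]
  have K_graph: "bipartite_graph K" by (rule bipartite_edges_imp_graph[OF K(2,1)])
  have K_verts: "card (verts K) = n" using K(1) n by (simp add: ivl_disj_un lessThan_atLeast0)
  have upper: "num_copies (star k) B \<le> num_copies (star k) K"
    if B: "bipartite_graph B" and Bn: "card (verts B) = n" and Be: "card (edges B) = e"
    for B :: "nat ugraph"
  proof (cases "k = 1")
    case True
    then show ?thesis
      using B K_graph Be K(3) by (simp add: num_copies_star_1[simplified] bipartite_graph_def)
  next
    case False
    then have k: "2 \<le> k" using assms(1) by simp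
    then obtain j where j: "k = Suc (Suc j)" by (metis add_2_eq_Suc le_Suc_ex)
    obtain X Y where XY: "bipartite_edges X Y (edges B)" and V: "verts B = X \<union> Y"
      using bipartite_graph_imp_edges[OF B] .
    interpret bipartite_edges X Y "edges B" by (rule XY)
    have card_XY: "card X + card Y = n"
      using Bn V finite_X finite_Y disjoint by (simp add: card_Un_disjoint)
    \<comment> \<open>Each side size is thus a candidate in the definition of
      \<open>qcb_size\<close>, so both sides have at least \<open>Suc s\<close> vertices.\<close>
    have "e \<le> card X * card Y" using card_E_le Be by simp
    moreover from this have "0 < card X" "0 < card Y" using assms(3) by (auto intro: gr0I)
    moreover have "n - card X = card Y" "n - card Y = card X" using card_XY by simp_all
    ultimately have "0 < card X \<and> e \<le> card X * (n - card X)"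
      and "0 < card Y \<and> e \<le> card Y * (n - card Y)"
      by (simp_all add: mult.commute)
    then have "Suc s \<le> card X" "Suc s \<le> card Y"
      unfolding t[symmetric] qcb_size_def by (auto intro: Least_le)
    then have "(\<Sum>v\<in>verts B. deg (edges B) v choose k) \<le> qc_sum s w r (\<lambda>d. d choose k)"
      unfolding V j using Be e n r card_XY by (intro sum_deg_choose_le) simp_all
    then show ?thesis
      using B K_graph K(4)[of "\<lambda>d. d choose k"]
      by (simp add: num_copies_star_ge_2 k bipartite_graph_def)
  qed
  show ?thesis
    unfolding ex_bip_def K_def[symmetric]
  proof (rule Max_eqI)
    show "num_copies (star k) K \<in> {num_copies (star k) B | B :: nat ugraph.
        bipartite_graph B \<and> card (verts B) = n \<and> card (edges B) = e}"
      using K_graph K_verts K(3) by blast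
    show "finite {num_copies (star k) B | B :: nat ugraph.
        bipartite_graph B \<and> card (verts B) = n \<and> card (edges B) = e}"
      \<comment> \<open>Finiteness of the set of values comes from the upper bound itself.\<close>
      by (rule finite_subset[of _ "{..num_copies (star k) K}"]) (use upper in auto)
  qed (use upper in blast)
qed

end
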